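(* Let $c:\mathbb{R}^d\times\mathbb{R}^d\to[0,\infty]$ be Borel measurable, symmetric, and lower semicontinuous, and let $\mu\in\mathcal{P}(\mathbb{R}^d)$. Then there exists $\gamma^{opt}\in\mathcal{P}^\infty_{sym}(\mathbb{R}^d)$ with $\gamma^{opt}\mapsto\mu$ and $C_\infty[\gamma^{opt}]=F^{OT}_\infty[\mu]$, and there exists an infinitely representable $\mu_2^{opt}\in\mathcal{P}_{sym}(\mathbb{R}^{2d})$ with $\mu_2^{opt}\mapsto\mu$ attaining the infimum $\inf\{\int c\,d\mu_2:\mu_2\in\mathcal{P}_{sym}(\mathbb{R}^{2d}),\ \mu_2\mapsto\mu,\ \mu_2\text{ infinitely representable}\}$.
   Context: $\mathcal{P}^\infty_{sym}(\mathbb{R}^d)$: Borel probability measures on the product $(\mathbb{R}^d)^\infty$ all of whose finite-dimensional marginals are invariant under permutations of the coordinates involved; $\gamma\mapsto\mu$ means the one-body marginal is $\mu$. $\mathcal{P}_{sym}(\mathbb{R}^{2d})$: Borel probability measures on $\mathbb{R}^d\times\mathbb{R}^d$ invariant under swapping the factors. $\mu_2$ is infinitely representable if some $\gamma\in\mathcal{P}^\infty_{sym}(\mathbb{R}^d)$ has two-body marginal (on any pair of coordinates) equal to $\mu_2$. $C_\infty[\gamma]:=\lim_{N\to\infty}\binom{N}{2}^{-1}\int\sum_{1\le i<j\le N}c(x_i,x_j)\,d\gamma$, $F^{OT}_\infty[\mu]:=\inf\{C_\infty[\gamma]:\gamma\in\mathcal{P}^\infty_{sym}(\mathbb{R}^d),\gamma\mapsto\mu\}$.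 *)

theory Defs
  imports "HOL-Probability.Probability" "HOL-Combinatorics.Permutations"
begin

text \<open>Points of R^d are elements of type real^'d. Configurations of infinitely many
particles are functions nat => real^'d, carrying the product sigma-algebra.\<close>

abbreviation inf_space :: "(nat \<Rightarrow> 'a::topological_space) measure" where
  "inf_space \<equiv> PiM UNIV (\<lambda>_. borel)"

definition borel_prob :: "'a::topological_space measure \<Rightarrow> bool" where
  "borel_prob \<mu> \<longleftrightarrow> prob_space \<mu> \<and> sets \<mu> = sets borel"

definition fin_marginal :: "(nat \<Rightarrow> 'a::topological_space) measure \<Rightarrow> nat set \<Rightarrow> (nat \<Rightarrow> 'a) measure" where
  "fin_marginal \<gamma> I = distr \<gamma> (PiM I (\<lambda>_. borel)) (\<lambda>x. restrict x I)"

definition P_inf_sym :: "(nat \<Rightarrow> 'a::topological_space) measure \<Rightarrow> bool" where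
  "P_inf_sym \<gamma> \<longleftrightarrow> prob_space \<gamma> \<and> sets \<gamma> = sets inf_space \<and>
     (\<forall>I \<sigma>. finite I \<longrightarrow> \<sigma> permutes I \<longrightarrow>
        distr (fin_marginal \<gamma> I) (PiM I (\<lambda>_. borel)) (\<lambda>y. restrict (\<lambda>i. y (\<sigma> i)) I)
          = fin_marginal \<gamma> I)"

definition one_body :: "(nat \<Rightarrow> 'a::topological_space) measure \<Rightarrow> 'a measure" where
  "one_body \<gamma> = distr \<gamma> borel (\<lambda>x. x 0)"

definition two_body :: "(nat \<Rightarrow> 'a::topological_space) measure \<Rightarrow> nat \<Rightarrow> nat \<Rightarrow> ('a \<times> 'a) measure" where
  "two_body \<gamma> i j = distr \<gamma> borel (\<lambda>x. (x i, x j))"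

definition P_sym2 :: "('a::topological_space \<times> 'a) measure \<Rightarrow> bool" where
  "P_sym2 \<mu>2 \<longleftrightarrow> borel_prob \<mu>2 \<and> distr \<mu>2 borel (\<lambda>(x, y). (y, x)) = \<mu>2"

definition pair_marg :: "('a::topological_space \<times> 'a) measure \<Rightarrow> 'a measure" where
  "pair_marg \<mu>2 = distr \<mu>2 borel fst"

definition inf_representable :: "('a::topological_space \<times> 'a) measure \<Rightarrow> bool" where
  "inf_representable \<mu>2 \<longleftrightarrow>
     (\<exists>\<gamma>. P_inf_sym \<gamma> \<and> (\<forall>i j. i \<noteq> j \<longrightarrow> two_body \<gamma> i j = \<mu>2))"

text \<open>C_infty[gamma] = lim_N binom(N,2)^{-1} int sum_{1<=i<j<=N} c(x_i,x_j) d gamma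
(coordinates indexed from 0 here).\<close>
definition C_inf :: "('a::topological_space \<Rightarrow> 'a \<Rightarrow> ennreal) \<Rightarrow> (nat \<Rightarrow> 'a) measure \<Rightarrow> ennreal" where
  "C_inf c \<gamma> = lim (\<lambda>N. (\<integral>\<^sup>+ x. (\<Sum>(i, j) \<in> {(i, j). i < j \<and> j < N}. c (x i) (x j)) \<partial>\<gamma>)
                         / of_nat (N choose 2))"

definition F_OT_inf :: "('a::topological_space \<Rightarrow> 'a \<Rightarrow> ennreal) \<Rightarrow> 'a measure \<Rightarrow> ennreal" where
  "F_OT_inf c \<mu> = (INF \<gamma> \<in> {\<gamma>. P_inf_sym \<gamma> \<and> one_body \<gamma> = \<mu>}. C_inf c \<gamma>)"

definition lsc :: "('a::topological_space \<Rightarrow> ennreal) \<Rightarrow> bool" where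
  "lsc f \<longleftrightarrow> (\<forall>t. open {p. t < f p})"

end

theory Submission
  imports Defs
begin

text \<open>By exchangeability, the cost is the integral of \<open>c (x 0) (x 1)\<close>, so it suffices to extract
  from a minimizing sequence a limit along which this integral is lower semicontinuous. Encode a
  configuration by the bits \<open>q < x j $ i\<close>, with \<open>q\<close> rational. The laws of the bits form a
  sequentially compact set (by Helly's theorem, since the Cantor space embeds into the line), so
  along a subsequence the probabilities of all events determined by finitely many bits converge. Since
  every one-particle marginal equals \<open>\<mu>\<close>, the limiting law of each block of bits is the encoded
  \<open>\<mu>\<close>; hence almost every limiting bit pattern is the encoding of a configuration, no mass
  escapes, and decoding yields a measure \<open>\<gamma>\<close>. Symmetry passes to the limit on the finite bit events,
  and a lower semicontinuous function is an increasing limit of functions of finitely many bits.\<close>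

section \<open>Sequential compactness of measures on the Cantor space\<close>

abbreviation bit_space :: "('k \<Rightarrow> bool) measure" where
  "bit_space \<equiv> PiM UNIV (\<lambda>_. count_space UNIV)"

text \<open>The usual homeomorphism of bit sequences with the middle-thirds Cantor set: only the
  ternary digits 0 and 2 occur, so the two values of a digit are separated by a gap and the digits
  are continuous on the image.\<close>

definition cantor_encode :: "(nat \<Rightarrow> bool) \<Rightarrow> real" where
  "cantor_encode \<omega> = (\<Sum>n. 2 * of_bool (\<omega> n) * (1/3) ^ Suc n)"

text \<open>Equal to 0 up to 1/3 and to 1 from 2/3 on, linear in between: half the first ternary
  digit on the Cantor set, extended across the removed middle third. On the Cantor set
  \<open>cantor_tail\<close> then shifts the ternary expansion by one digit.\<close>

definition cantor_head :: "real \<Rightarrow> real" where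
  "cantor_head y = min 1 (max 0 (3 * y - 1))"

definition cantor_tail :: "real \<Rightarrow> real" where
  "cantor_tail y = 3 * y - 2 * cantor_head y"

text \<open>On the Cantor set the ternary digits are continuous; this is a continuous extension of the
  \<open>n\<close>-th one to the whole line.\<close>
definition cantor_bit :: "nat \<Rightarrow> real \<Rightarrow> real" where
  "cantor_bit n y = cantor_head ((cantor_tail ^^ n) y)"

lemma summable_cantor: "summable (\<lambda>n. 2 * of_bool (\<omega> n) * (1/3::real) ^ Suc n)"
proof (rule summable_comparison_test')
  show "summable (\<lambda>n. 2 * (1/3::real) ^ Suc n)"
    by (intro summable_mult summable_Suc_iff[THEN iffD2] summable_geometric) auto
qed (auto simp: of_bool_def)

lemma cantor_encode_Suc:
  "cantor_encode \<omega> = (2 * of_bool (\<omega> 0) + cantor_encode (\<lambda>n. \<omega> (Suc n))) / 3"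
proof -
  have "cantor_encode \<omega> = (\<Sum>n. 2 * of_bool (\<omega> (Suc n)) * (1/3) ^ Suc (Suc n)) + 2 * of_bool (\<omega> 0) / 3"
    unfolding cantor_encode_def using suminf_split_head[OF summable_cantor, of \<omega>] by simp
  also have "(\<Sum>n. 2 * of_bool (\<omega> (Suc n)) * (1/3::real) ^ Suc (Suc n)) =
      (\<Sum>n. (2 * of_bool (\<omega> (Suc n)) * (1/3) ^ Suc n) * (1/3))"
    by (intro suminf_cong) simp
  also have "\<dots> = cantor_encode (\<lambda>n. \<omega> (Suc n)) * (1/3)"
    unfolding cantor_encode_def by (intro suminf_mult2[symmetric] summable_cantor)
  finally show ?thesis by (simp add: field_simps)
qed

lemma cantor_encode_bounds: "0 \<le> cantor_encode \<omega>" "cantor_encode \<omega> \<le> 1"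
proof -
  show "0 \<le> cantor_encode \<omega>"
    unfolding cantor_encode_def by (intro suminf_nonneg summable_cantor) auto
  have s: "(\<lambda>n. (2/3) * (1/3::real) ^ n) sums ((2/3) * (1 / (1 - 1/3)))"
    by (intro sums_mult geometric_sums) auto
  have "cantor_encode \<omega> \<le> (\<Sum>n. (2/3) * (1/3::real) ^ n)"
    unfolding cantor_encode_def
    by (intro suminf_le summable_cantor sums_summable[OF s]) (auto simp: of_bool_def)
  also have "\<dots> = 1" using sums_unique[OF s] by simp
  finally show "cantor_encode \<omega> \<le> 1" .
qed

text \<open>By the bounds on the encoded tail, an encoded sequence lies in \<open>[0, 1/3]\<close>
  or in \<open>[2/3, 1]\<close> according to its first bit, and \<open>cantor_head\<close> is
  constant on either interval.\<close>

lemma cantor_head_encode: "cantor_head (cantor_encode \<omega>) = of_bool (\<omega> 0)"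
  using cantor_encode_bounds[of "\<lambda>n. \<omega> (Suc n)"]
  by (subst cantor_encode_Suc) (auto simp: cantor_head_def min_def max_def field_simps)

lemma cantor_tail_encode: "cantor_tail (cantor_encode \<omega>) = cantor_encode (\<lambda>n. \<omega> (Suc n))"
  unfolding cantor_tail_def cantor_head_encode by (subst cantor_encode_Suc) (simp add: add_divide_distrib)

lemma cantor_bit_encode: "cantor_bit n (cantor_encode \<omega>) = of_bool (\<omega> n)"
proof -
  have "(cantor_tail ^^ n) (cantor_encode \<omega>) = cantor_encode (\<lambda>m. \<omega> (n + m))"
    by (induction n) (auto simp: cantor_tail_encode)
  then show ?thesis by (simp add: cantor_bit_def cantor_head_encode)
qed

lemma isCont_cantor_bit: "isCont (cantor_bit n) y"
proof -
  have tail: "continuous_on UNIV cantor_tail"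
    unfolding cantor_tail_def cantor_head_def by (intro continuous_intros)
  have "continuous_on UNIV (cantor_tail ^^ n)"
  proof (induction n)
    case (Suc n)
    then show ?case using continuous_on_compose2[OF tail Suc] by (simp add: comp_def)
  qed (simp add: id_def)
  then have "continuous_on UNIV (cantor_bit n)"
    unfolding cantor_bit_def cantor_head_def by (intro continuous_intros)
  then show ?thesis by (simp add: continuous_on_eq_continuous_at)
qed

lemma borel_measurable_cantor_bit [measurable]: "cantor_bit n \<in> borel_measurable borel"
  by (intro borel_measurable_continuous_onI) (simp add: continuous_at_imp_continuous_on isCont_cantor_bit)

lemma cantor_bit_bounds: "0 \<le> cantor_bit n y" "cantor_bit n y \<le> 1"
  by (auto simp: cantor_bit_def cantor_head_def)

text \<open>The reindexing \<open>e\<close> is meant for an enumeration of a countable index type,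
  by which bits indexed by that type are read as one sequence.\<close>

lemma borel_measurable_cantor_encode [measurable]:
  fixes e :: "nat \<Rightarrow> 'k"
  shows "(\<lambda>\<omega>. cantor_encode (\<lambda>n. \<omega> (e n))) \<in> borel_measurable bit_space"
proof -
  have "(\<lambda>\<omega>. of_bool (\<omega> k) :: real) \<in> borel_measurable bit_space" for k :: 'k
    by (rule measurable_compose[OF measurable_component_singleton]) auto
  then show ?thesis
    unfolding cantor_encode_def by (intro borel_measurable_suminf) measurable
qed

lemma cylinder_in_sets_bit_space [measurable]:
  "finite J \<Longrightarrow> {\<omega>. \<forall>k\<in>J. \<omega> k = f k} \<in> sets bit_space"
proof -
  assume J: "finite J"
  have "Measurable.pred bit_space (\<lambda>\<omega>. \<omega> k = f k)" for k
    by (rule measurable_compose[OF measurable_component_singleton]) auto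
  then have "Measurable.pred bit_space (\<lambda>\<omega>. \<forall>k\<in>J. \<omega> k = f k)"
    using J by (intro pred_intros_finite) auto
  then show ?thesis by (simp add: pred_def space_PiM)
qed

text \<open>The encoded laws live on \<open>[0, 1]\<close>, hence are tight, and a subsequence
  converges weakly to a law \<open>M\<close> on the line. Decoding \<open>M\<close> gives the limit:
  cylinder indicators are bounded continuous functions of the encoding, so their integrals
  converge.\<close>

theorem bit_space_sequentially_compact:
  fixes P :: "nat \<Rightarrow> ('k::countable \<Rightarrow> bool) measure"
  assumes prob: "\<And>n. prob_space (P n)" and sets: "\<And>n. sets (P n) = sets bit_space"
  obtains r Q where "strict_mono (r::nat \<Rightarrow> nat)" "prob_space Q" "sets Q = sets bit_space"
    "\<And>J f. finite J \<Longrightarrow>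
      (\<lambda>n. measure (P (r n)) {\<omega>. \<forall>k\<in>J. \<omega> k = f k}) \<longlonglongrightarrow> measure Q {\<omega>. \<forall>k\<in>J. \<omega> k = f k}"
proof -
  define g :: "('k \<Rightarrow> bool) \<Rightarrow> real" where "g = (\<lambda>\<omega>. cantor_encode (\<lambda>n. \<omega> (from_nat n)))"
  define b :: "'k \<Rightarrow> real \<Rightarrow> real" where "b k = cantor_bit (to_nat k)" for k
  have b_g: "b k (g \<omega>) = of_bool (\<omega> k)" for k \<omega>
    by (simp add: b_def g_def cantor_bit_encode)
  have g_meas [measurable]: "g \<in> borel_measurable bit_space"
    unfolding g_def by measurable
  have g_meas_P: "g \<in> borel_measurable (P n)" for n
    using g_meas by (simp add: measurable_cong_sets[OF sets refl])
  have b_meas [measurable]: "b k \<in> borel_measurable borel" for k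
    unfolding b_def by measurable
  define \<mu> where "\<mu> n = distr (P n) borel g" for n
  have rd: "real_distribution (\<mu> n)" for n
    unfolding \<mu>_def using prob_space.real_distribution_distr[OF prob] g_meas_P by blast
  have "tight \<mu>"
    unfolding tight_def
  proof (intro conjI allI impI rd)
    fix \<epsilon> :: real assume "\<epsilon> > 0"
    \<comment> \<open>Tightness asks for half-open intervals; the left end -1 keeps the possible
      value 0 inside.\<close>
    have "measure (\<mu> n) {-1<..1} = 1" for n
    proof -
      interpret prob_space "P n" by (rule prob)
      have "-1 < g \<omega>" "g \<omega> \<le> 1" for \<omega>
        using cantor_encode_bounds[of "\<lambda>n. \<omega> (from_nat n)"] by (simp_all add: g_def)
      then have "g -` {-1<..1} \<inter> space (P n) = space (P n)"
        by auto
      then show ?thesis unfolding \<mu>_def by (subst measure_distr[OF g_meas_P]) (auto simp: prob_space)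
    qed
    with \<open>\<epsilon> > 0\<close> show "\<exists>a b. a < b \<and> (\<forall>n. 1 - \<epsilon> < measure (\<mu> n) {a<..b})"
      by (intro exI[of _ "-1"] exI[of _ 1]) auto
  qed
  from tight_imp_convergent_subsubsequence[OF this strict_mono_id]
  obtain r M where r: "strict_mono r" and M: "real_distribution M" and w: "weak_conv_m (\<mu> \<circ> r) M"
    by (auto simp: comp_def)
  interpret M: real_distribution M by (rule M)
  have conv: "(\<lambda>n. \<integral>\<omega>. F (g \<omega>) \<partial>P (r n)) \<longlonglongrightarrow> (\<integral>y. F y \<partial>M)"
    if F: "\<And>y. isCont F y" "\<And>y. norm (F y) \<le> B" for F :: "real \<Rightarrow> real" and B
  proof -
    have [measurable]: "F \<in> borel_measurable borel"
      by (intro borel_measurable_continuous_onI) (simp add: continuous_at_imp_continuous_on F)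
    have "(\<lambda>n. integral\<^sup>L ((\<mu> \<circ> r) n) F) \<longlonglongrightarrow> integral\<^sup>L M F"
      using weak_conv_imp_integral_bdd_continuous_conv[OF _ M w F] rd by auto
    then show ?thesis
      by (simp add: \<mu>_def integral_distr g_meas_P)
  qed
  \<comment> \<open>Every real is decoded to some pattern, also where a value \<open>b k y\<close>
    lies strictly between 0 and 1; \<open>bits\<close> shows that \<open>M\<close> gives such points
    no mass.\<close>
  define Q where "Q = distr M bit_space (\<lambda>y k. b k y = 1)"
  have dec [measurable]: "(\<lambda>y k. b k y = 1) \<in> measurable M bit_space"
    by (rule measurable_PiM_single') (auto simp: M.events_eq_borel space_PiM)
  \<comment> \<open>The continuous function \<open>b k y * (1 - b k y)\<close> is non-negative and
    vanishes at all encoded sequences, so its integral under the weak limit is 0.\<close>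
  have bits: "AE y in M. \<forall>k. b k y = 0 \<or> b k y = 1"
  proof (subst AE_all_countable, intro allI)
    fix k
    have nn: "0 \<le> b k y * (1 - b k y)" "b k y * (1 - b k y) \<le> 1" for y
      using cantor_bit_bounds[of "to_nat k" y] by (auto simp: b_def intro: mult_le_one)
    have "(\<lambda>n. \<integral>\<omega>. b k (g \<omega>) * (1 - b k (g \<omega>)) \<partial>P (r n)) \<longlonglongrightarrow> (\<integral>y. b k y * (1 - b k y) \<partial>M)"
    proof (rule conv)
      show "isCont (\<lambda>y. b k y * (1 - b k y)) y" for y
        unfolding b_def by (intro continuous_intros isCont_cantor_bit)
      show "norm (b k y * (1 - b k y)) \<le> 1" for y using nn[of y] by auto
    qed
    moreover have "b k (g \<omega>) * (1 - b k (g \<omega>)) = 0" for \<omega> by (simp add: b_g)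
    ultimately have "(\<integral>y. b k y * (1 - b k y) \<partial>M) = 0"
      by (simp add: LIMSEQ_const_iff)
    moreover have "integrable M (\<lambda>y. b k y * (1 - b k y))"
      by (rule M.integrable_const_bound[where B = 1]) (use nn in auto)
    ultimately have "AE y in M. b k y * (1 - b k y) = 0"
      using nn by (subst (asm) integral_nonneg_eq_0_iff_AE) auto
    then show "AE y in M. b k y = 0 \<or> b k y = 1" by eventually_elim auto
  qed
  have Q: "prob_space Q" unfolding Q_def by (rule M.prob_space_distr[OF dec])
  show thesis
  proof (rule that[OF r Q])
    show "sets Q = sets bit_space" by (simp add: Q_def)
    fix J :: "'k set" and f assume J: "finite J"
    \<comment> \<open>A continuous extension of the cylinder's indicator: at an encoded sequence
      each factor is 1 or 0 according to whether bit \<open>k\<close> agrees with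
      \<open>f k\<close>.\<close>
    define F where "F y = (\<Prod>k\<in>J. if f k then b k y else 1 - b k y)" for y
    have F01: "0 \<le> F y" "F y \<le> 1" for y
      using cantor_bit_bounds by (auto simp: F_def b_def intro!: prod_nonneg prod_le_1)
    have Fg: "F (g \<omega>) = indicator {\<omega>. \<forall>k\<in>J. \<omega> k = f k} \<omega>" for \<omega>
      using J by (auto simp: F_def b_g indicator_def intro!: prod.neutral)
    have "(\<lambda>n. \<integral>\<omega>. F (g \<omega>) \<partial>P (r n)) \<longlonglongrightarrow> (\<integral>y. F y \<partial>M)"
    proof (rule conv)
      have "isCont (\<lambda>y. if f k then b k y else 1 - b k y) y" for k y
        using isCont_cantor_bit[of y "to_nat k"]
        by (cases "f k") (simp_all add: b_def continuous_diff)
      then show "isCont F y" for y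
        unfolding F_def by (intro continuous_prod)
      show "norm (F y) \<le> 1" for y using F01 by auto
    qed
    also have "(\<lambda>n. \<integral>\<omega>. F (g \<omega>) \<partial>P (r n)) = (\<lambda>n. measure (P (r n)) {\<omega>. \<forall>k\<in>J. \<omega> k = f k})"
      using sets_eq_imp_space_eq[OF sets] by (simp add: Fg space_PiM)
    also have "(\<integral>y. F y \<partial>M) = (\<integral>y. indicator {\<omega>. \<forall>k\<in>J. \<omega> k = f k} (\<lambda>k. b k y = 1) \<partial>M)"
    proof (rule integral_cong_AE)
      show "AE y in M. F y = indicator {\<omega>. \<forall>k\<in>J. \<omega> k = f k} (\<lambda>k. b k y = 1)"
        using bits
      proof eventually_elim
        case (elim y)
        show ?case
        proof (cases "\<forall>k\<in>J. (b k y = 1) = f k")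
          case True
          with elim show ?thesis by (auto simp: F_def indicator_def intro!: prod.neutral)
        next
          case False
          with elim J show ?thesis by (auto simp: F_def indicator_def)
        qed
      qed
      show "F \<in> borel_measurable M" unfolding F_def by measurable
      show "(\<lambda>y. indicator {\<omega>. \<forall>k\<in>J. \<omega> k = f k} (\<lambda>k. b k y = 1)) \<in> borel_measurable M"
        using J by measurable
    qed
    also have "\<dots> = (\<integral>\<omega>. indicator {\<omega>. \<forall>k\<in>J. \<omega> k = f k} \<omega> \<partial>Q)"
      unfolding Q_def using J by (subst integral_distr[OF dec]) auto
    also have "\<dots> = measure Q {\<omega>. \<forall>k\<in>J. \<omega> k = f k}"
      by (simp add: Q_def space_PiM)
    finally show "(\<lambda>n. measure (P (r n)) {\<omega>. \<forall>k\<in>J. \<omega> k = f k}) \<longlonglongrightarrow> measure Q {\<omega>. \<forall>k\<in>J. \<omega> k = f k}" .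
  qed
qed

section \<open>Encoding configurations by bits\<close>

text \<open>The cylinders over patterns on \<open>J\<close> partition the space. As the patterns are
  extensional, the only one whose cylinder contains \<open>\<omega>\<close> is
  \<open>restrict \<omega> J\<close>. Integrals of such functions thus become finite sums of
  cylinder masses.\<close>

lemma finite_bits_decomp:
  fixes F :: "('k \<Rightarrow> bool) \<Rightarrow> ennreal"
  assumes "finite J"
  shows "F (restrict \<omega> J) = (\<Sum>f\<in>J \<rightarrow>\<^sub>E UNIV. F f * indicator {\<omega>. \<forall>k\<in>J. \<omega> k = f k} \<omega>)"
proof -
  have "F f * indicator {\<omega>. \<forall>k\<in>J. \<omega> k = f k} \<omega> = (if f = restrict \<omega> J then F f else 0)"
    if f: "f \<in> J \<rightarrow>\<^sub>E UNIV" for f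
  proof -
    have "(\<forall>k\<in>J. \<omega> k = f k) \<longleftrightarrow> f = restrict \<omega> J"
      using f by (auto simp: fun_eq_iff restrict_def PiE_iff extensional_def)
    then show ?thesis by (simp only: indicator_def mem_Collect_eq of_bool_def) simp
  qed
  then have "(\<Sum>f\<in>J \<rightarrow>\<^sub>E UNIV. F f * indicator {\<omega>. \<forall>k\<in>J. \<omega> k = f k} \<omega>) =
      (\<Sum>f\<in>J \<rightarrow>\<^sub>E UNIV. if f = restrict \<omega> J then F f else 0)"
    by (rule sum.cong[OF refl])
  also have "\<dots> = F (restrict \<omega> J)"
    using assms by (subst sum.delta) (auto simp: finite_PiE)
  finally show ?thesis ..
qed

lemma borel_measurable_finite_bits:
  fixes F :: "('k \<Rightarrow> bool) \<Rightarrow> ennreal"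
  assumes "finite J"
  shows "(\<lambda>\<omega>. F (restrict \<omega> J)) \<in> borel_measurable bit_space"
  unfolding finite_bits_decomp[OF assms, where F = F] using assms by measurable

lemma nn_integral_finite_bits:
  fixes F :: "('k \<Rightarrow> bool) \<Rightarrow> ennreal"
  assumes J: "finite J" and sets: "sets M = sets bit_space"
  shows "(\<integral>\<^sup>+\<omega>. F (restrict \<omega> J) \<partial>M) =
    (\<Sum>f\<in>J \<rightarrow>\<^sub>E UNIV. F f * emeasure M {\<omega>. \<forall>k\<in>J. \<omega> k = f k})"
  unfolding finite_bits_decomp[OF J, where F = F]
  using cylinder_in_sets_bit_space[OF J]
  by (subst nn_integral_sum)
    (auto simp: nn_integral_cmult_indicator sets measurable_cong_sets[OF sets refl])

text \<open>Finite-dimensional rectangles generate the product sigma-algebra, and the indicator of a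
  rectangle over \<open>J\<close> is a function of the bits in \<open>J\<close>, so its integral is
  determined by cylinder masses.\<close>

lemma bit_space_measure_eqI:
  assumes P: "finite_measure P" "sets P = sets bit_space" and Q: "sets Q = sets bit_space"
    and eq: "\<And>J f. finite J \<Longrightarrow>
      emeasure P {\<omega>. \<forall>k\<in>J. \<omega> k = f k} = emeasure Q {\<omega>. \<forall>k\<in>J. \<omega> k = f k}"
  shows "P = Q"
proof (rule measure_eqI_PiM_infinite[OF P(2) Q _ P(1)])
  fix A :: "'a \<Rightarrow> bool set" and J :: "'a set"
  assume J: "finite J"
  let ?X = "prod_emb UNIV (\<lambda>_. count_space UNIV) J (Pi\<^sub>E J A)"
  have X: "?X \<in> sets bit_space" using J by (intro sets_PiM_I) auto
  have "(indicator ?X \<omega> :: ennreal) = indicator (Pi\<^sub>E J A) (restrict \<omega> J)" for \<omega>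
    by (auto simp: indicator_def prod_emb_def space_PiM)
  then have "emeasure M ?X = (\<integral>\<^sup>+\<omega>. indicator (Pi\<^sub>E J A) (restrict \<omega> J) \<partial>M)"
    if "sets M = sets bit_space" for M
    using that X by (simp flip: nn_integral_indicator)
  then show "emeasure P ?X = emeasure Q ?X"
    by (simp add: P(2) Q nn_integral_finite_bits[OF J] eq[OF J])
qed

section \<open>Encoding points and configurations by rational cuts\<close>

definition vec_bits :: "real^'d \<Rightarrow> 'd \<times> rat \<Rightarrow> bool" where
  "vec_bits x = (\<lambda>(i, q). of_rat q < x $ i)"

text \<open>Each coordinate is recovered as the supremum of its lower Dedekind cut. Taking it in the
  extended reals gives a value to every pattern, encoded or not; \<open>real_of_ereal\<close> sends
  infinite suprema to 0.\<close>

definition vec_of_bits :: "('d \<times> rat \<Rightarrow> bool) \<Rightarrow> real^'d" where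
  "vec_of_bits \<eta> = (\<chi> i. real_of_ereal (SUP q. if \<eta> (i, q) then ereal (of_rat q) else -\<infinity>))"

definition conf_bits :: "(nat \<Rightarrow> real^'d) \<Rightarrow> nat \<times> 'd \<times> rat \<Rightarrow> bool" where
  "conf_bits x = (\<lambda>(j, k). vec_bits (x j) k)"

definition conf_of_bits :: "(nat \<times> 'd \<times> rat \<Rightarrow> bool) \<Rightarrow> nat \<Rightarrow> real^'d" where
  "conf_of_bits \<omega> = (\<lambda>j. vec_of_bits (\<lambda>k. \<omega> (j, k)))"

lemma vec_of_bits_vec_bits [simp]: "vec_of_bits (vec_bits x) = x"
proof -
  have "(SUP q. if vec_bits x (i, q) then ereal (of_rat q) else -\<infinity>) = ereal (x $ i)" for i
  proof (rule antisym)
    show "(SUP q. if vec_bits x (i, q) then ereal (of_rat q) else -\<infinity>) \<le> ereal (x $ i)"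
      by (rule SUP_least) (auto simp: vec_bits_def)
    show "ereal (x $ i) \<le> (SUP q. if vec_bits x (i, q) then ereal (of_rat q) else -\<infinity>)"
    proof (rule dense_le)
      fix y assume "y < ereal (x $ i)"
      then obtain z where z: "y < ereal z" "z < x $ i" using ereal_dense2 by force
      obtain q where q: "z < of_rat q" "of_rat q < x $ i" using of_rat_dense[OF z(2)] by blast
      have "y \<le> ereal (of_rat q)"
        using z(1) q(1) by (meson less_ereal.simps(1) less_imp_le less_trans)
      with q show "y \<le> (SUP q. if vec_bits x (i, q) then ereal (of_rat q) else -\<infinity>)"
        by (intro SUP_upper2[of q]) (auto simp: vec_bits_def)
    qed
  qed
  then show ?thesis by (simp add: vec_of_bits_def vec_eq_iff)
qed

lemma conf_of_bits_conf_bits [simp]: "conf_of_bits (conf_bits x) = x"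
  by (simp add: conf_of_bits_def conf_bits_def)

lemma measurable_vec_bits [measurable]: "vec_bits \<in> measurable borel bit_space"
proof (rule measurable_PiM_single')
  fix k :: "'a \<times> rat"
  show "(\<lambda>x. vec_bits x k) \<in> measurable borel (count_space UNIV)"
    unfolding vec_bits_def case_prod_beta by measurable
qed (auto simp: space_PiM)

lemma measurable_vec_of_bits [measurable]: "vec_of_bits \<in> measurable bit_space borel"
proof -
  have [measurable]: "(\<lambda>\<eta>. \<eta> k) \<in> measurable bit_space (count_space UNIV)" for k :: "'a \<times> rat"
    by (rule measurable_component_singleton) simp
  have "(\<lambda>\<eta>. real_of_ereal (SUP q. if \<eta> (i, q) then ereal (of_rat q) else -\<infinity>)) \<in> borel_measurable bit_space"
    for i :: 'a
    by measurable
  then show ?thesis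
    unfolding vec_of_bits_def
    by (subst borel_measurable_euclidean_space)
      (auto simp: Basis_vec_def inner_axis)
qed

lemma measurable_conf_bits [measurable]: "conf_bits \<in> measurable inf_space bit_space"
proof (rule measurable_PiM_single')
  fix k :: "nat \<times> 'a \<times> rat"
  have 1: "(\<lambda>x::nat \<Rightarrow> real^'a. vec_bits (x (fst k))) \<in> measurable inf_space bit_space"
    by measurable
  show "(\<lambda>x. conf_bits x k) \<in> measurable inf_space (count_space UNIV)"
    unfolding conf_bits_def case_prod_beta
    by (rule measurable_compose[OF 1]) (rule measurable_component_singleton, simp)
qed (auto simp: space_PiM)

lemma measurable_block [measurable]: "(\<lambda>\<omega> k. \<omega> (j, k)) \<in> measurable bit_space bit_space"
  by (rule measurable_PiM_single') (auto simp: space_PiM)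

lemma measurable_conf_of_bits [measurable]: "conf_of_bits \<in> measurable bit_space inf_space"
  unfolding conf_of_bits_def
  by (rule measurable_PiM_single') (auto simp: space_PiM intro: measurable_compose[OF measurable_block])

text \<open>The fixed marginal takes the place of tightness: it fixes the law of each particle's
  bits along the sequence, hence in the limit, so the limiting patterns are almost surely encodings
  of points and can be decoded without loss of mass.\<close>

lemma configurations_compact:
  fixes \<gamma> :: "nat \<Rightarrow> (nat \<Rightarrow> real^'d) measure" and \<mu> :: "(real^'d) measure"
  assumes prob: "\<And>n. prob_space (\<gamma> n)" and sets: "\<And>n. sets (\<gamma> n) = sets inf_space"
    and marg: "\<And>n j. distr (\<gamma> n) borel (\<lambda>x. x j) = \<mu>"
  obtains r \<gamma>' where "strict_mono (r::nat \<Rightarrow> nat)" "prob_space \<gamma>'" "sets \<gamma>' = sets inf_space"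
    "\<And>j. distr \<gamma>' borel (\<lambda>x. x j) = \<mu>"
    "\<And>J f. finite J \<Longrightarrow> (\<lambda>n. emeasure (distr (\<gamma> (r n)) bit_space conf_bits) {\<omega>. \<forall>k\<in>J. \<omega> k = f k})
      \<longlonglongrightarrow> emeasure (distr \<gamma>' bit_space conf_bits) {\<omega>. \<forall>k\<in>J. \<omega> k = f k}"
proof -
  have meas [measurable]: "conf_bits \<in> measurable (\<gamma> n) bit_space"
      "(\<lambda>x. x j) \<in> measurable (\<gamma> n) borel" for n j
    by (auto simp: measurable_cong_sets[OF sets refl])
  define P where "P n = distr (\<gamma> n) bit_space conf_bits" for n
  have P: "prob_space (P n)" "sets (P n) = sets bit_space" for n
    unfolding P_def using prob_space.prob_space_distr[OF prob meas(1)] by auto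
  obtain r Q where r: "strict_mono r" and Q: "prob_space Q" "sets Q = sets bit_space"
    and conv: "\<And>J f. finite J \<Longrightarrow> (\<lambda>n. measure (P (r n)) {\<omega>. \<forall>k\<in>J. \<omega> k = f k})
        \<longlonglongrightarrow> measure Q {\<omega>. \<forall>k\<in>J. \<omega> k = f k}"
    using bit_space_sequentially_compact[of P] P by blast
  interpret Q: prob_space Q by fact
  note Q_cong = measurable_cong_sets[OF Q(2) refl]
  have [measurable]: "(\<lambda>\<omega> k. \<omega> (j, k)) \<in> measurable Q bit_space" for j :: nat
    using measurable_block by (simp add: Q_cong)
  have "prob_space \<mu>" "sets \<mu> = sets borel"
    using prob_space.prob_space_distr[OF prob meas(2)] marg by (force, metis sets_distr)
  note \<mu>_cong = measurable_cong_sets[OF this(2) refl]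
  have [measurable]: "vec_bits \<in> measurable \<mu> bit_space"
    by (simp add: \<mu>_cong)
  have block_P: "distr (P n) bit_space (\<lambda>\<omega> k. \<omega> (j, k)) = distr \<mu> bit_space vec_bits" for n j
  proof -
    have "distr (P n) bit_space (\<lambda>\<omega> k. \<omega> (j, k)) = distr (\<gamma> n) bit_space (\<lambda>x. vec_bits (x j))"
      unfolding P_def by (subst distr_distr) (auto simp: comp_def conf_bits_def)
    also have "\<dots> = distr (distr (\<gamma> n) borel (\<lambda>x. x j)) bit_space vec_bits"
      by (subst distr_distr) (auto simp: comp_def)
    finally show ?thesis by (simp add: marg)
  qed
  \<comment> \<open>A cylinder on the bits of particle \<open>j\<close> is a cylinder of the whole
    bit space over the indices \<open>(j, k)\<close> with \<open>k\<close> in \<open>J\<close>; this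
    is the form in which convergence is known.\<close>
  have cyl: "measure (distr N bit_space (\<lambda>\<omega> k. \<omega> (j, k))) {\<omega>. \<forall>k\<in>J. \<omega> k = f k} =
      measure N {\<omega>. \<forall>k\<in>Pair j ` J. \<omega> k = f (snd k)}"
    if "finite J" "sets N = sets bit_space" for N and j :: nat and J :: "('d \<times> rat) set" and f
  proof -
    have "(\<lambda>\<omega> k. \<omega> (j, k)) \<in> measurable N bit_space"
      using measurable_block by (simp add: measurable_cong_sets[OF that(2) refl])
    with that show ?thesis
      using sets_eq_imp_space_eq[OF that(2)]
      by (subst measure_distr) (auto simp: vimage_def space_PiM)
  qed
  \<comment> \<open>By \<open>block_P\<close> the cylinder probabilities of block \<open>j\<close>
    do not vary along the subsequence, so their limits are the same constants, and cylinders
    determine the law.\<close>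
  have block_Q: "distr Q bit_space (\<lambda>\<omega> k. \<omega> (j, k)) = distr \<mu> bit_space vec_bits" for j
  proof (rule bit_space_measure_eqI)
    interpret D: prob_space "distr Q bit_space (\<lambda>\<omega> k. \<omega> (j, k))"
      by (rule Q.prob_space_distr) measurable
    interpret E: prob_space "distr \<mu> bit_space vec_bits"
      by (rule prob_space.prob_space_distr[OF \<open>prob_space \<mu>\<close>]) measurable
    show "finite_measure (distr Q bit_space (\<lambda>\<omega> k. \<omega> (j, k)))" by unfold_locales
    fix J :: "('d \<times> rat) set" and f assume J: "finite J"
    have "(\<lambda>n. measure (P (r n)) {\<omega>. \<forall>k\<in>Pair j ` J. \<omega> k = f (snd k)})
        \<longlonglongrightarrow> measure Q {\<omega>. \<forall>k\<in>Pair j ` J. \<omega> k = f (snd k)}"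
      using J by (intro conv[where f = "\<lambda>k. f (snd k)"]) auto
    then have "measure (distr Q bit_space (\<lambda>\<omega> k. \<omega> (j, k))) {\<omega>. \<forall>k\<in>J. \<omega> k = f k} =
        measure (distr \<mu> bit_space vec_bits) {\<omega>. \<forall>k\<in>J. \<omega> k = f k}"
      unfolding cyl[OF J P(2), symmetric] cyl[OF J Q(2), symmetric] block_P
      by (simp add: LIMSEQ_const_iff)
    then show "emeasure (distr Q bit_space (\<lambda>\<omega> k. \<omega> (j, k))) {\<omega>. \<forall>k\<in>J. \<omega> k = f k} =
        emeasure (distr \<mu> bit_space vec_bits) {\<omega>. \<forall>k\<in>J. \<omega> k = f k}"
      by (simp add: D.emeasure_eq_measure E.emeasure_eq_measure)
  qed auto
  \<comment> \<open>Decoding and re-encoding fixes every pattern of the form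
    \<open>vec_bits x\<close>, hence almost every pattern under the block law
    \<open>distr \<mu> bit_space vec_bits\<close>. As there are countably many bits, one null set
    serves for all of them.\<close>
  have AE_Q: "AE \<omega> in Q. \<forall>k. conf_bits (conf_of_bits \<omega>) k = \<omega> k"
  proof (subst AE_all_countable, intro allI)
    fix k :: "nat \<times> 'd \<times> rat"
    obtain j l where k: "k = (j, l)" by (cases k)
    have comp: "(\<lambda>\<eta>. \<eta> l) \<in> measurable bit_space (count_space UNIV)"
      by (rule measurable_component_singleton) simp
    have "(\<lambda>\<eta>. vec_bits (vec_of_bits \<eta>) l) \<in> measurable bit_space (count_space UNIV)"
      by (rule measurable_compose[OF _ comp]) measurable
    then have [measurable]: "Measurable.pred bit_space (\<lambda>\<eta>. vec_bits (vec_of_bits \<eta>) l = \<eta> l)"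
      using comp by (intro pred_intros_logic)
    have "AE \<eta> in distr \<mu> bit_space vec_bits. vec_bits (vec_of_bits \<eta>) l = \<eta> l"
      by (subst AE_distr_iff) auto
    then have "AE \<eta> in distr Q bit_space (\<lambda>\<omega> k. \<omega> (j, k)). vec_bits (vec_of_bits \<eta>) l = \<eta> l"
      by (subst block_Q)
    then show "AE \<omega> in Q. conf_bits (conf_of_bits \<omega>) k = \<omega> k"
      by (subst (asm) AE_distr_iff) (auto simp: k conf_bits_def conf_of_bits_def)
  qed
  have dec [measurable]: "conf_of_bits \<in> measurable Q inf_space" by (simp add: Q_cong)
  define \<gamma>' where "\<gamma>' = distr Q inf_space conf_of_bits"
  \<comment> \<open>Re-encoding the decoded limit returns \<open>Q\<close> itself, so convergence to
    \<open>Q\<close> is convergence to the bit law of \<open>\<gamma>'\<close>.\<close>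
  have law: "distr \<gamma>' bit_space conf_bits = Q"
  proof -
    have "distr \<gamma>' bit_space conf_bits = distr Q bit_space (\<lambda>\<omega>. conf_bits (conf_of_bits \<omega>))"
      unfolding \<gamma>'_def by (subst distr_distr) (auto simp: comp_def)
    also have "\<dots> = distr Q Q (\<lambda>\<omega>. \<omega>)"
    proof (rule distr_cong_AE)
      show "AE \<omega> in Q. conf_bits (conf_of_bits \<omega>) = \<omega>"
        using AE_Q by eventually_elim (simp add: fun_eq_iff)
    qed (auto simp: Q)
    finally show ?thesis by simp
  qed
  show thesis
  proof (rule that[OF r])
    show "prob_space \<gamma>'" unfolding \<gamma>'_def by (rule Q.prob_space_distr) measurable
    show "sets \<gamma>' = sets inf_space" by (simp add: \<gamma>'_def)
    show "distr \<gamma>' borel (\<lambda>x. x j) = \<mu>" for j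
    proof -
      have "distr \<gamma>' borel (\<lambda>x. x j) = distr Q borel (\<lambda>\<omega>. vec_of_bits (\<lambda>k. \<omega> (j, k)))"
        unfolding \<gamma>'_def by (subst distr_distr) (auto simp: comp_def conf_of_bits_def)
      also have "\<dots> = distr (distr Q bit_space (\<lambda>\<omega> k. \<omega> (j, k))) borel vec_of_bits"
        by (subst distr_distr) (auto simp: comp_def)
      also have "\<dots> = \<mu>"
        unfolding block_Q using \<open>sets \<mu> = sets borel\<close>
        by (subst distr_distr) (auto simp: comp_def distr_id2)
      finally show ?thesis .
    qed
    fix J :: "(nat \<times> 'd \<times> rat) set" and f assume "finite J"
    from conv[OF this, of f] show "(\<lambda>n. emeasure (distr (\<gamma> (r n)) bit_space conf_bits) {\<omega>. \<forall>k\<in>J. \<omega> k = f k})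
      \<longlonglongrightarrow> emeasure (distr \<gamma>' bit_space conf_bits) {\<omega>. \<forall>k\<in>J. \<omega> k = f k}"
      using finite_measure.emeasure_eq_measure[OF prob_space.finite_measure[OF P(1)]]
      by (simp add: law Q.emeasure_eq_measure flip: P_def)
  qed
qed

section \<open>Passing to the limit\<close>

text \<open>The last hypothesis is lower semicontinuity of \<open>f\<close> for the topology of bit
  cylinders. It makes \<open>f\<close> an increasing supremum of functions of finitely many bits;
  their integrals converge, being finite sums over cylinders, and each of them lies below
  \<open>f\<close>.\<close>

lemma nn_integral_le_liminf_of_bits:
  fixes \<gamma> :: "nat \<Rightarrow> (nat \<Rightarrow> real^'d) measure" and f :: "(nat \<Rightarrow> real^'d) \<Rightarrow> ennreal"
  assumes sets: "\<And>n. sets (\<gamma> n) = sets inf_space" and sets': "sets \<gamma>' = sets inf_space"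
    and conv: "\<And>J f. finite J \<Longrightarrow>
      (\<lambda>n. emeasure (distr (\<gamma> n) bit_space conf_bits) {\<omega>. \<forall>k\<in>J. \<omega> k = f k})
        \<longlonglongrightarrow> emeasure (distr \<gamma>' bit_space conf_bits) {\<omega>. \<forall>k\<in>J. \<omega> k = f k}"
    and lsc: "\<And>x t. t < f x \<Longrightarrow>
      \<exists>J. finite J \<and> (\<forall>y. (\<forall>k\<in>J. conf_bits y k = conf_bits x k) \<longrightarrow> t < f y)"
  shows "(\<integral>\<^sup>+x. f x \<partial>\<gamma>') \<le> liminf (\<lambda>n. \<integral>\<^sup>+x. f x \<partial>\<gamma> n)"
proof -
  define J :: "nat \<Rightarrow> (nat \<times> 'd \<times> rat) set" where "J m = {k. to_nat k < m}" for m
  have J: "finite (J m)" for m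
  proof (rule finite_imageD)
    show "finite (to_nat ` J m)" by (rule finite_subset[of _ "{..<m}"]) (auto simp: J_def)
  qed simp
  \<comment> \<open>the largest function below \<open>f\<close> and \<open>m\<close> that depends only on the bits in \<open>J m\<close>\<close>
  define H where "H m \<eta> = min (of_nat m) (INF y\<in>{y. \<forall>k\<in>J m. conf_bits y k = \<eta> k}. f y)" for m \<eta>
  define G where "G m x = H m (restrict (conf_bits x) (J m))" for m x
  have G: "G m x = min (of_nat m) (INF y\<in>{y. \<forall>k\<in>J m. conf_bits y k = conf_bits x k}. f y)" for m x
    by (simp add: G_def H_def)
  have G_le: "G m x \<le> f x" for m x
    unfolding G by (rule min.coboundedI2) (rule INF_lower, simp)
  have "mono G"
  proof (rule monoI, rule le_funI)
    fix m n :: nat and x assume "m \<le> n"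
    then have "J m \<subseteq> J n" by (auto simp: J_def)
    with \<open>m \<le> n\<close> show "G m x \<le> G n x"
      unfolding G by (intro min.mono INF_superset_mono) auto
  qed
  \<comment> \<open>A level \<open>t\<close> below \<open>f x\<close> is secured by finitely many
    bits of \<open>x\<close>. Once \<open>J m\<close> contains them and the cap
    \<open>of_nat m\<close> exceeds \<open>t\<close>, also \<open>t \<le> G m x\<close>.\<close>
  have sup: "(SUP m. G m x) = f x" for x
  proof (rule antisym)
    show "(SUP m. G m x) \<le> f x" by (rule SUP_least) (rule G_le)
    show "f x \<le> (SUP m. G m x)"
    proof (rule dense_le)
      fix t assume t: "t < f x"
      then obtain I where I: "finite I" "\<And>y. (\<forall>k\<in>I. conf_bits y k = conf_bits x k) \<Longrightarrow> t < f y"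
        using lsc by blast
      obtain a where "t < of_nat a"
        using ennreal_Ex_less_of_nat[of t] t less_top less_le_trans by (metis infinity_ennreal_def top_greatest)
      obtain b where b: "to_nat ` I \<subseteq> {..<b}"
        using finite_nat_iff_bounded[of "to_nat ` I"] I(1) by auto
      define m where "m = max a b"
      have "I \<subseteq> J m" using b by (auto simp: J_def m_def)
      have "t \<le> G m x"
        unfolding G
      proof (rule min.boundedI)
        have "(of_nat a :: ennreal) \<le> of_nat m" by (simp add: m_def)
        with \<open>t < of_nat a\<close> show "t \<le> of_nat m" by (meson less_imp_le less_le_trans)
        show "t \<le> (INF y\<in>{y. \<forall>k\<in>J m. conf_bits y k = conf_bits x k}. f y)"
          by (rule INF_greatest) (use I(2) \<open>I \<subseteq> J m\<close> in \<open>auto intro!: less_imp_le\<close>)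
      qed
      then show "t \<le> (SUP m. G m x)" by (rule SUP_upper2[rotated]) simp
    qed
  qed
  have int_G: "(\<integral>\<^sup>+x. G m x \<partial>N) = (\<Sum>g\<in>J m \<rightarrow>\<^sub>E UNIV. H m g *
      emeasure (distr N bit_space conf_bits) {\<omega>. \<forall>k\<in>J m. \<omega> k = g k})"
    and meas_G: "G m \<in> borel_measurable N" if N: "sets N = sets inf_space" for m N
  proof -
    have c: "conf_bits \<in> measurable N bit_space"
      by (simp add: measurable_cong_sets[OF N refl])
    note m = borel_measurable_finite_bits[OF J, of "H m" m]
    show "G m \<in> borel_measurable N"
      using measurable_compose[OF c m] unfolding G_def[abs_def] .
    show "(\<integral>\<^sup>+x. G m x \<partial>N) = (\<Sum>g\<in>J m \<rightarrow>\<^sub>E UNIV. H m g *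
        emeasure (distr N bit_space conf_bits) {\<omega>. \<forall>k\<in>J m. \<omega> k = g k})"
      unfolding G_def using nn_integral_distr[OF c, of "\<lambda>\<omega>. H m (restrict \<omega> (J m))"] m
        nn_integral_finite_bits[OF J, where M = "distr N bit_space conf_bits"]
      by simp
  qed
  have "(\<integral>\<^sup>+x. f x \<partial>\<gamma>') = (SUP m. \<integral>\<^sup>+x. G m x \<partial>\<gamma>')"
    using nn_integral_monotone_convergence_SUP[of G \<gamma>'] \<open>mono G\<close> meas_G[OF sets']
    by (simp add: sup)
  also have "\<dots> \<le> liminf (\<lambda>n. \<integral>\<^sup>+x. f x \<partial>\<gamma> n)"
  proof (rule SUP_least)
    fix m
    \<comment> \<open>The cap in \<open>H\<close> keeps the coefficients finite; multiplication by
      \<open>top\<close> is not continuous at 0 and would not pass to the limit.\<close>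
    have fin: "H m g \<noteq> top" for g
      unfolding H_def by (rule neq_top_trans[OF ennreal_of_nat_neq_top min.cobounded1])
    have "(\<lambda>n. \<integral>\<^sup>+x. G m x \<partial>\<gamma> n) \<longlonglongrightarrow> (\<integral>\<^sup>+x. G m x \<partial>\<gamma>')"
      unfolding int_G[OF sets] int_G[OF sets']
      by (intro tendsto_sum ennreal_tendsto_cmult conv J) (simp add: fin less_top[symmetric])
    then have "(\<integral>\<^sup>+x. G m x \<partial>\<gamma>') = liminf (\<lambda>n. \<integral>\<^sup>+x. G m x \<partial>\<gamma> n)"
      by (simp add: lim_imp_Liminf)
    also have "\<dots> \<le> liminf (\<lambda>n. \<integral>\<^sup>+x. f x \<partial>\<gamma> n)"
      by (intro Liminf_mono always_eventually allI nn_integral_mono G_le)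
    finally show "(\<integral>\<^sup>+x. G m x \<partial>\<gamma>') \<le> liminf (\<lambda>n. \<integral>\<^sup>+x. f x \<partial>\<gamma> n)" .
  qed
  finally show ?thesis .
qed

text \<open>Otherwise there are \<open>y n\<close> that share the first \<open>n\<close> bits of
  \<open>x\<close> and violate the inequality. Each comparison with a rational is then eventually
  the same for \<open>y n\<close> as for \<open>x\<close>, so every particle converges, against the
  openness of the superlevel set of \<open>h\<close>.\<close>

lemma lsc_finite_bits:
  fixes h :: "(real^'d) \<times> (real^'d) \<Rightarrow> ennreal"
  assumes "lsc h" and t: "t < h (x i, x j)"
  shows "\<exists>J. finite J \<and> (\<forall>y. (\<forall>k\<in>J. conf_bits y k = conf_bits x k) \<longrightarrow> t < h (y i, y j))"
proof (rule ccontr)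
  assume *: "\<not> ?thesis"
  have "\<exists>y. (\<forall>k. to_nat k < n \<longrightarrow> conf_bits y k = conf_bits x k) \<and> \<not> t < h (y i, y j)" for n :: nat
  proof -
    have "finite {k :: nat \<times> 'd \<times> rat. to_nat k < n}"
      by (rule finite_imageD[of to_nat], rule finite_subset[of _ "{..<n}"]) auto
    then have "\<not> (\<forall>y. (\<forall>k\<in>{k. to_nat k < n}. conf_bits y k = conf_bits x k) \<longrightarrow> t < h (y i, y j))"
      using * by meson
    then show ?thesis by auto
  qed
  then obtain y where y: "\<And>n k. to_nat k < n \<Longrightarrow> conf_bits (y n) k = conf_bits x k"
    and not_less: "\<And>n. \<not> t < h (y n i, y n j)"
    by metis
  have ev: "\<forall>\<^sub>F n in sequentially. (of_rat q < y n l $ a) = (of_rat q < x l $ a)" for l a q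
    using eventually_gt_at_top[of "to_nat (l, a, q)"]
    by eventually_elim (use y in \<open>force simp: conf_bits_def vec_bits_def\<close>)
  have lim: "(\<lambda>n. y n l) \<longlonglongrightarrow> x l" for l
  proof (rule vec_tendstoI, rule order_tendstoI)
    fix a u assume "u < x l $ a"
    then obtain q where "u < of_rat q" "of_rat q < x l $ a" using of_rat_dense by blast
    with ev[of q l a] show "\<forall>\<^sub>F n in sequentially. u < y n l $ a"
      by (auto elim!: eventually_mono)
  next
    fix a u assume "x l $ a < u"
    \<comment> \<open>The bit at \<open>q\<close> is false for \<open>x\<close>, hence eventually
      for \<open>y n\<close>, which gives \<open>y n l $ a \<le> of_rat q < u\<close>.\<close>
    then obtain q where "x l $ a < of_rat q" "of_rat q < u" using of_rat_dense by blast
    with ev[of q l a] show "\<forall>\<^sub>F n in sequentially. y n l $ a < u"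
      by (auto elim!: eventually_mono)
  qed
  have "(\<lambda>n. (y n i, y n j)) \<longlonglongrightarrow> (x i, x j)" by (intro tendsto_Pair lim)
  moreover have "open {p. t < h p}" using \<open>lsc h\<close> by (simp add: lsc_def)
  ultimately have "\<forall>\<^sub>F n in sequentially. (y n i, y n j) \<in> {p. t < h p}"
    using t by (intro topological_tendstoD) auto
  with not_less show False by (auto simp: eventually_sequentially)
qed

section \<open>Exchangeability of the infinite law and its passage to the limit\<close>

lemma measurable_reindex: "(\<lambda>x i. x (\<sigma> i)) \<in> measurable inf_space inf_space"
  by (rule measurable_PiM_single') (auto simp: space_PiM)

text \<open>Replaces invariance of the finite marginals by invariance of the whole law under
  finitely supported permutations. Given a rectangle over \<open>J\<close> and a permutation of
  \<open>I\<close>, the marginal on \<open>I \<union> J\<close> sees both, as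
  \<open>\<sigma>\<close> permutes this larger set too.\<close>

lemma P_inf_sym_iff:
  "P_inf_sym \<gamma> \<longleftrightarrow> prob_space \<gamma> \<and> sets \<gamma> = sets inf_space \<and>
     (\<forall>I \<sigma>. finite I \<longrightarrow> \<sigma> permutes I \<longrightarrow> distr \<gamma> inf_space (\<lambda>x i. x (\<sigma> i)) = \<gamma>)"
proof (cases "prob_space \<gamma> \<and> sets \<gamma> = sets inf_space")
  case True
  then interpret prob_space \<gamma> by simp
  from True have sets: "sets \<gamma> = sets inf_space" by simp
  note cong = measurable_cong_sets[OF sets refl]
  have meas_reindex: "(\<lambda>x i. x (\<sigma> i)) \<in> measurable \<gamma> inf_space" for \<sigma>
    by (simp add: cong measurable_reindex)
  have res: "(\<lambda>x. restrict x I) \<in> measurable inf_space (PiM I (\<lambda>_. borel))"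
      "(\<lambda>x. restrict x I) \<in> measurable \<gamma> (PiM I (\<lambda>_. borel))" for I
    by (auto simp: cong intro!: measurable_restrict_subset)
  \<comment> \<open>Since \<open>\<sigma>\<close> maps \<open>I\<close> into itself, permuting the
    restricted coordinates is the same as restricting the permuted ones.\<close>
  have marg_perm: "distr (fin_marginal \<gamma> I) (PiM I (\<lambda>_. borel)) (\<lambda>y. restrict (\<lambda>i. y (\<sigma> i)) I)
      = distr (distr \<gamma> inf_space (\<lambda>x i. x (\<sigma> i))) (PiM I (\<lambda>_. borel)) (\<lambda>x. restrict x I)"
    if "\<sigma> permutes I" for I \<sigma>
  proof -
    have perm: "(\<lambda>y. restrict (\<lambda>i. y (\<sigma> i)) I) \<in> measurable (PiM I (\<lambda>_. borel)) (PiM I (\<lambda>_. borel))"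
      using permutes_in_image[OF that]
      by (intro measurable_restrict measurable_component_singleton) auto
    have eq: "restrict (\<lambda>i. restrict x I (\<sigma> i)) I = restrict (\<lambda>i. x (\<sigma> i)) I" for x :: "nat \<Rightarrow> 'a"
      using permutes_in_image[OF that] by (auto simp: restrict_def)
    have "distr (fin_marginal \<gamma> I) (PiM I (\<lambda>_. borel)) (\<lambda>y. restrict (\<lambda>i. y (\<sigma> i)) I)
        = distr \<gamma> (PiM I (\<lambda>_. borel)) (\<lambda>x. restrict (\<lambda>i. restrict x I (\<sigma> i)) I)"
      unfolding fin_marginal_def by (simp only: distr_distr[OF perm res(2)] comp_def)
    also have "\<dots> = distr \<gamma> (PiM I (\<lambda>_. borel)) (\<lambda>x. restrict (\<lambda>i. x (\<sigma> i)) I)"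
      by (simp only: eq)
    also have "\<dots> = distr (distr \<gamma> inf_space (\<lambda>x i. x (\<sigma> i))) (PiM I (\<lambda>_. borel)) (\<lambda>x. restrict x I)"
      by (simp only: distr_distr[OF res(1) meas_reindex] comp_def)
    finally show ?thesis .
  qed
  have "distr \<gamma> inf_space (\<lambda>x i. x (\<sigma> i)) = \<gamma>"
    if "finite I" and \<sigma>: "\<sigma> permutes I"
      and inv: "\<And>I \<sigma>. finite I \<Longrightarrow> \<sigma> permutes I \<Longrightarrow>
        distr (fin_marginal \<gamma> I) (PiM I (\<lambda>_. borel)) (\<lambda>y. restrict (\<lambda>i. y (\<sigma> i)) I) = fin_marginal \<gamma> I"
    for I \<sigma>
  proof (rule measure_eqI_PiM_infinite)
    show "finite_measure (distr \<gamma> inf_space (\<lambda>x i. x (\<sigma> i)))"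
      by (rule finite_measure_distr[OF meas_reindex])
    fix A :: "nat \<Rightarrow> 'a set" and J :: "nat set"
    assume J: "finite J" and A: "\<And>i. i \<in> J \<Longrightarrow> A i \<in> sets borel"
    let ?B = "prod_emb (I \<union> J) (\<lambda>_. borel) J (Pi\<^sub>E J A)"
    let ?X = "prod_emb UNIV (\<lambda>_. borel) J (Pi\<^sub>E J A)"
    have B: "?B \<in> sets (PiM (I \<union> J) (\<lambda>_. borel))"
      using J A by (intro sets_PiM_I) auto
    have X: "(\<lambda>x. restrict x (I \<union> J)) -` ?B = ?X"
      by (auto simp: prod_emb_def space_PiM restrict_def PiE_iff extensional_def)
    have *: "emeasure (distr N (PiM (I \<union> J) (\<lambda>_. borel)) (\<lambda>x. restrict x (I \<union> J))) ?B = emeasure N ?X"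
      if N: "sets N = sets inf_space" for N
    proof -
      have "(\<lambda>x. restrict x (I \<union> J)) \<in> measurable N (PiM (I \<union> J) (\<lambda>_. borel))"
        using res(1) by (simp only: measurable_cong_sets[OF N refl])
      then show ?thesis
        using B sets_eq_imp_space_eq[OF N] by (subst emeasure_distr) (auto simp: X space_PiM)
    qed
    have "\<sigma> permutes (I \<union> J)" using \<sigma> by (rule permutes_subset) auto
    with inv[OF _ this] marg_perm[OF this] \<open>finite I\<close> J
    have "distr (distr \<gamma> inf_space (\<lambda>x i. x (\<sigma> i))) (PiM (I \<union> J) (\<lambda>_. borel)) (\<lambda>x. restrict x (I \<union> J))
        = distr \<gamma> (PiM (I \<union> J) (\<lambda>_. borel)) (\<lambda>x. restrict x (I \<union> J))"
      by (simp add: fin_marginal_def)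
    then show "emeasure (distr \<gamma> inf_space (\<lambda>x i. x (\<sigma> i))) ?X = emeasure \<gamma> ?X"
      by (metis * sets sets_distr)
  qed (simp_all add: sets)
  moreover have "distr (fin_marginal \<gamma> I) (PiM I (\<lambda>_. borel)) (\<lambda>y. restrict (\<lambda>i. y (\<sigma> i)) I) = fin_marginal \<gamma> I"
    if "\<sigma> permutes I" "distr \<gamma> inf_space (\<lambda>x i. x (\<sigma> i)) = \<gamma>" for I \<sigma>
    using marg_perm[OF that(1)] that(2) by (simp add: fin_marginal_def)
  ultimately show ?thesis
    using True unfolding P_inf_sym_def by metis
qed (auto simp: P_inf_sym_def)

text \<open>Permuting particles relabels bits and turns cylinders into cylinders, so the invariance
  of cylinder probabilities passes to the limit.\<close>

lemma P_inf_sym_limit: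
  fixes \<gamma> :: "nat \<Rightarrow> (nat \<Rightarrow> real^'d) measure"
  assumes sym: "\<And>n. P_inf_sym (\<gamma> n)" and prob: "prob_space \<gamma>'" and sets': "sets \<gamma>' = sets inf_space"
    and conv: "\<And>J f. finite J \<Longrightarrow>
      (\<lambda>n. emeasure (distr (\<gamma> n) bit_space conf_bits) {\<omega>. \<forall>k\<in>J. \<omega> k = f k})
        \<longlonglongrightarrow> emeasure (distr \<gamma>' bit_space conf_bits) {\<omega>. \<forall>k\<in>J. \<omega> k = f k}"
  shows "P_inf_sym \<gamma>'"
  unfolding P_inf_sym_iff
proof (intro conjI allI impI prob sets')
  fix I and \<sigma> :: "nat \<Rightarrow> nat" assume I: "finite I" "\<sigma> permutes I"
  then have "inj \<sigma>" by (blast dest: permutes_inj)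
  let ?\<pi> = "\<lambda>(x :: nat \<Rightarrow> real^'d) i. x (\<sigma> i)"
  have meas: "?\<pi> \<in> measurable N inf_space" "conf_bits \<in> measurable N bit_space"
    if "sets N = sets inf_space" for N
    by (simp_all add: measurable_cong_sets[OF that refl] measurable_reindex)
  \<comment> \<open>Bit \<open>k\<close> of the permuted configuration is bit
    \<open>map_prod \<sigma> id k\<close> of the original one; the inverse of
    \<open>\<sigma>\<close> carries the prescribed values along.\<close>
  have law_perm: "emeasure (distr (distr N inf_space ?\<pi>) bit_space conf_bits) {\<omega>. \<forall>k\<in>J. \<omega> k = f k} =
      emeasure (distr N bit_space conf_bits) {\<omega>. \<forall>k\<in>map_prod \<sigma> id ` J. \<omega> k = f (map_prod (inv \<sigma>) id k)}"
    if N: "sets N = sets inf_space" and J: "finite J" for N J f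
  proof -
    have bits: "conf_bits (?\<pi> x) k = conf_bits x (map_prod \<sigma> id k)" for x k
      by (cases k) (simp add: conf_bits_def)
    have inv: "map_prod (inv \<sigma>) id (map_prod \<sigma> id k) = k" for k :: "nat \<times> 'd \<times> rat"
      using \<open>inj \<sigma>\<close> by (cases k) simp
    have space: "space N = UNIV" using sets_eq_imp_space_eq[OF N] by (simp add: space_PiM)
    have "emeasure (distr (distr N inf_space ?\<pi>) bit_space conf_bits) {\<omega>. \<forall>k\<in>J. \<omega> k = f k} =
        emeasure N {x. \<forall>k\<in>J. conf_bits (?\<pi> x) k = f k}"
      using J measurable_compose[OF meas(1)[OF N] measurable_conf_bits]
      by (simp add: distr_distr[OF measurable_conf_bits meas(1)[OF N]] emeasure_distr space vimage_def comp_def)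
    also have "{x. \<forall>k\<in>J. conf_bits (?\<pi> x) k = f k} =
        {x. \<forall>k\<in>map_prod \<sigma> id ` J. conf_bits x k = f (map_prod (inv \<sigma>) id k)}"
      unfolding Ball_image_comp comp_def bits inv ..
    also have "emeasure N \<dots> = emeasure (distr N bit_space conf_bits)
        {\<omega>. \<forall>k\<in>map_prod \<sigma> id ` J. \<omega> k = f (map_prod (inv \<sigma>) id k)}"
      using J meas(2)[OF N] cylinder_in_sets_bit_space[of "map_prod \<sigma> id ` J"]
      by (subst emeasure_distr) (auto simp only: finite_imageI space vimage_def mem_Collect_eq Int_UNIV_right)
    finally show ?thesis .
  qed
  have "distr (distr \<gamma>' inf_space ?\<pi>) bit_space conf_bits = distr \<gamma>' bit_space conf_bits"
  proof (rule bit_space_measure_eqI)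
    interpret prob_space \<gamma>' by fact
    have "prob_space (distr (distr \<gamma>' inf_space ?\<pi>) bit_space conf_bits)"
      by (intro prob_space.prob_space_distr prob_space_distr meas) (auto simp: sets')
    then show "finite_measure (distr (distr \<gamma>' inf_space ?\<pi>) bit_space conf_bits)"
      by (rule prob_space.finite_measure)
    fix J :: "(nat \<times> 'd \<times> rat) set" and f assume J: "finite J"
    have s: "sets (\<gamma> n) = sets inf_space" "distr (\<gamma> n) inf_space ?\<pi> = \<gamma> n" for n
      using sym[of n] I unfolding P_inf_sym_iff by blast+
    have "(\<lambda>n. emeasure (distr (\<gamma> n) bit_space conf_bits) {\<omega>. \<forall>k\<in>J. \<omega> k = f k})
        \<longlonglongrightarrow> emeasure (distr (distr \<gamma>' inf_space ?\<pi>) bit_space conf_bits) {\<omega>. \<forall>k\<in>J. \<omega> k = f k}"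
      using conv[of "map_prod \<sigma> id ` J" "\<lambda>k. f (map_prod (inv \<sigma>) id k)"] J
      unfolding law_perm[OF sets' J] law_perm[OF s(1) J, symmetric] s(2) by simp
    with conv[OF J] show "emeasure (distr (distr \<gamma>' inf_space ?\<pi>) bit_space conf_bits) {\<omega>. \<forall>k\<in>J. \<omega> k = f k} =
        emeasure (distr \<gamma>' bit_space conf_bits) {\<omega>. \<forall>k\<in>J. \<omega> k = f k}"
      by (blast intro: LIMSEQ_unique)
  qed auto
  \<comment> \<open>The bit law determines the law of the configuration, because decoding is a left
    inverse of encoding.\<close>
  moreover have "distr (distr N bit_space conf_bits) inf_space conf_of_bits = N"
    if N: "sets N = sets inf_space" for N :: "(nat \<Rightarrow> real^'d) measure"
    using meas(2)[OF N] N by (subst distr_distr) (auto simp: comp_def distr_id2)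
  ultimately show "distr \<gamma>' inf_space ?\<pi> = \<gamma>'"
    using sets' by (metis sets_distr)
qed

section \<open>Reduction to two particles and the minimizer\<close>

lemma two_body_permute:
  fixes \<gamma> :: "(nat \<Rightarrow> 'a::second_countable_topology) measure"
  assumes \<gamma>: "P_inf_sym \<gamma>" and \<sigma>: "finite I" "\<sigma> permutes I"
  shows "two_body \<gamma> (\<sigma> i) (\<sigma> j) = two_body \<gamma> i j"
proof -
  have sets: "sets \<gamma> = sets inf_space" and inv: "distr \<gamma> inf_space (\<lambda>x i. x (\<sigma> i)) = \<gamma>"
    using assms by (auto simp: P_inf_sym_iff)
  have m: "(\<lambda>x i. x (\<sigma> i)) \<in> measurable \<gamma> inf_space"
    using measurable_reindex by (simp only: measurable_cong_sets[OF sets refl])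
  have p: "(\<lambda>x::nat \<Rightarrow> 'a. (x i, x j)) \<in> borel_measurable inf_space"
    by (intro borel_measurable_Pair measurable_component_singleton) auto
  have "two_body \<gamma> i j = distr (distr \<gamma> inf_space (\<lambda>x i. x (\<sigma> i))) borel (\<lambda>x. (x i, x j))"
    by (simp only: inv two_body_def)
  also have "\<dots> = two_body \<gamma> (\<sigma> i) (\<sigma> j)"
    by (simp only: distr_distr[OF p m] comp_def two_body_def)
  finally show ?thesis ..
qed

lemma two_body_eq:
  fixes \<gamma> :: "(nat \<Rightarrow> 'a::second_countable_topology) measure"
  assumes \<gamma>: "P_inf_sym \<gamma>" and "i \<noteq> j"
  shows "two_body \<gamma> i j = two_body \<gamma> 0 1"
proof -
  \<comment> \<open>Swapping \<open>0\<close> and \<open>i\<close> carries \<open>(i, j)\<close> to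
    \<open>(0, ?k)\<close>. Here \<open>?k\<close> is not 0 because \<open>i\<close> and
    \<open>j\<close> differ, so swapping \<open>1\<close> and \<open>?k\<close> fixes 0 and carries
    \<open>(0, ?k)\<close> to \<open>(0, 1)\<close>.\<close>
  let ?k = "Transposition.transpose 0 i j"
  have "Transposition.transpose 1 ?k 0 = 0" using \<open>i \<noteq> j\<close> by (auto simp: Transposition.transpose_def)
  then have "two_body \<gamma> 0 1 = two_body \<gamma> (Transposition.transpose 1 ?k 0) (Transposition.transpose 1 ?k ?k)" by simp
  also have "\<dots> = two_body \<gamma> 0 ?k"
    by (rule two_body_permute[OF \<gamma>, of "{1, ?k}"]) (auto intro: permutes_swap_id)
  also have "\<dots> = two_body \<gamma> (Transposition.transpose 0 i i) (Transposition.transpose 0 i j)" by simp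
  also have "\<dots> = two_body \<gamma> i j"
    by (rule two_body_permute[OF \<gamma>, of "{0, i}"]) (auto intro: permutes_swap_id)
  finally show ?thesis ..
qed

lemma distr_fst_two_body:
  fixes \<gamma> :: "(nat \<Rightarrow> 'a::second_countable_topology) measure"
  assumes sets: "sets \<gamma> = sets inf_space"
  shows "distr (two_body \<gamma> i j) borel fst = distr \<gamma> borel (\<lambda>x. x i)"
proof -
  have p: "(\<lambda>x::nat \<Rightarrow> 'a. (x i, x j)) \<in> borel_measurable \<gamma>"
    unfolding measurable_cong_sets[OF sets refl]
    by (intro borel_measurable_Pair measurable_component_singleton) auto
  have f: "(fst :: 'a \<times> 'a \<Rightarrow> 'a) \<in> borel_measurable borel"
    by (intro borel_measurable_continuous_onI continuous_intros)
  show ?thesis by (simp only: two_body_def distr_distr[OF f p] comp_def fst_conv)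
qed

lemma one_coordinate_eq:
  fixes \<gamma> :: "(nat \<Rightarrow> 'a::second_countable_topology) measure"
  assumes \<gamma>: "P_inf_sym \<gamma>"
  shows "distr \<gamma> borel (\<lambda>x. x i) = one_body \<gamma>"
proof -
  have sets: "sets \<gamma> = sets inf_space" using \<gamma> by (simp add: P_inf_sym_def)
  \<comment> \<open>Coordinate \<open>i\<close> is viewed as the first of a pair of distinct
    coordinates; \<open>Suc i\<close> serves as its partner.\<close>
  have "distr (two_body \<gamma> i (Suc i)) borel fst = distr (two_body \<gamma> 0 1) borel fst"
    using two_body_eq[OF \<gamma>, of i "Suc i"] by simp
  then show ?thesis by (simp add: distr_fst_two_body[OF sets] one_body_def)
qed

lemma nn_integral_two_body:
  fixes c :: "'a::second_countable_topology \<Rightarrow> 'a \<Rightarrow> ennreal"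
  assumes sets: "sets \<gamma> = sets inf_space" and c: "(\<lambda>(x, y). c x y) \<in> borel_measurable borel"
  shows "(\<integral>\<^sup>+p. c (fst p) (snd p) \<partial>two_body \<gamma> i j) = (\<integral>\<^sup>+x. c (x i) (x j) \<partial>\<gamma>)"
    and "(\<lambda>x. c (x i) (x j)) \<in> borel_measurable \<gamma>"
proof -
  have p: "(\<lambda>x::nat \<Rightarrow> 'a. (x i, x j)) \<in> borel_measurable \<gamma>"
    unfolding measurable_cong_sets[OF sets refl]
    by (intro borel_measurable_Pair measurable_component_singleton) auto
  show "(\<integral>\<^sup>+p. c (fst p) (snd p) \<partial>two_body \<gamma> i j) = (\<integral>\<^sup>+x. c (x i) (x j) \<partial>\<gamma>)"
    using c unfolding two_body_def by (subst nn_integral_distr[OF p]) (auto simp: case_prod_beta')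
  show "(\<lambda>x. c (x i) (x j)) \<in> borel_measurable \<gamma>"
    using measurable_compose[OF p c] by simp
qed

section \<open>The limiting cost as the cost of one pair\<close>

lemma card_ordered_pairs: "card {(i, j). i < j \<and> j < (N::nat)} = N choose 2"
proof -
  have "{(i, j). i < j \<and> j < N} = (\<Union>j\<in>{..<N}. (\<lambda>i. (i, j)) ` {..<j})" by auto
  also have "card \<dots> = (\<Sum>j<N. card ((\<lambda>i. (i, j)) ` {..<j}))"
    by (rule card_UN_disjoint) auto
  also have "\<dots> = \<Sum>{..<N}" by (intro sum.cong) (auto simp: card_image inj_on_def)
  also have "\<dots> = N choose 2"
    by (cases N) (simp_all add: choose_two gauss_sum_nat lessThan_Suc_atMost atMost_atLeast0 mult.commute)
  finally show ?thesis .
qed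

text \<open>All pairs of distinct coordinates have the same joint law, so each of the
  \<open>N choose 2\<close> terms integrates to the cost of the pair \<open>(0, 1)\<close>. The
  quotients are constant from \<open>N = 2\<close> on, where the binomial is non-zero; this includes
  the case of infinite cost.\<close>

lemma C_inf_eq:
  fixes c :: "'a::second_countable_topology \<Rightarrow> 'a \<Rightarrow> ennreal"
  assumes \<gamma>: "P_inf_sym \<gamma>" and c: "(\<lambda>(x, y). c x y) \<in> borel_measurable borel"
  shows "C_inf c \<gamma> = (\<integral>\<^sup>+x. c (x 0) (x 1) \<partial>\<gamma>)"
proof -
  have sets: "sets \<gamma> = sets inf_space" using \<gamma> by (simp add: P_inf_sym_def)
  let ?V = "\<integral>\<^sup>+x. c (x 0) (x 1) \<partial>\<gamma>"
  have pair: "(\<integral>\<^sup>+x. c (x i) (x j) \<partial>\<gamma>) = ?V" if "i \<noteq> j" for i j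
    using two_body_eq[OF \<gamma> that] by (simp only: nn_integral_two_body(1)[OF sets c, symmetric])
  have "(\<integral>\<^sup>+x. (\<Sum>(i, j)\<in>{(i, j). i < j \<and> j < N}. c (x i) (x j)) \<partial>\<gamma>) / of_nat (N choose 2) = ?V"
    if "N \<ge> 2" for N
  proof -
    have "(\<integral>\<^sup>+x. (\<Sum>(i, j)\<in>{(i, j). i < j \<and> j < N}. c (x i) (x j)) \<partial>\<gamma>) =
        (\<Sum>p\<in>{(i, j). i < j \<and> j < N}. \<integral>\<^sup>+x. c (x (fst p)) (x (snd p)) \<partial>\<gamma>)"
      unfolding case_prod_beta by (rule nn_integral_sum) (rule nn_integral_two_body(2)[OF sets c])
    also have "\<dots> = (\<Sum>p\<in>{(i, j). i < j \<and> j < N}. ?V)"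
      by (rule sum.cong[OF refl], rule pair) auto
    also have "\<dots> = of_nat (N choose 2) * ?V"
      by (simp only: sum_constant card_ordered_pairs)
    finally have "(\<integral>\<^sup>+x. (\<Sum>(i, j)\<in>{(i, j). i < j \<and> j < N}. c (x i) (x j)) \<partial>\<gamma>) = ?V * of_nat (N choose 2)"
      by (simp only: mult.commute)
    moreover have "(of_nat (N choose 2) :: ennreal) \<noteq> 0" using that by (simp add: binomial_eq_0_iff)
    ultimately show ?thesis by (simp add: ennreal_mult_divide_eq)
  qed
  then have "(\<lambda>N. (\<integral>\<^sup>+x. (\<Sum>(i, j)\<in>{(i, j). i < j \<and> j < N}. c (x i) (x j)) \<partial>\<gamma>) / of_nat (N choose 2)) \<longlonglongrightarrow> ?V"
    by (intro tendsto_eventually eventually_sequentiallyI[of 2])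
  then show ?thesis unfolding C_inf_def by (rule limI)
qed

text \<open>The law of independent particles shows that competitors exist, so that a minimizing
  sequence can be chosen. A permutation only reindexes identical factors.\<close>

lemma P_inf_sym_product:
  fixes \<mu> :: "'a::topological_space measure"
  assumes "borel_prob \<mu>"
  shows "P_inf_sym (PiM UNIV (\<lambda>_. \<mu>))" "one_body (PiM UNIV (\<lambda>_. \<mu>)) = \<mu>"
proof -
  have \<mu>: "prob_space \<mu>" and sets: "sets \<mu> = sets borel" using assms by (auto simp: borel_prob_def)
  have sets_PiM: "sets (PiM UNIV (\<lambda>_::nat. \<mu>)) = sets inf_space"
    by (rule sets_PiM_cong) (auto simp: sets)
  show "P_inf_sym (PiM UNIV (\<lambda>_. \<mu>))"
    unfolding P_inf_sym_iff
  proof (intro conjI allI impI)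
    show "prob_space (PiM UNIV (\<lambda>_::nat. \<mu>))" by (rule prob_space_PiM) (rule \<mu>)
    fix I and \<sigma> :: "nat \<Rightarrow> nat" assume "\<sigma> permutes I"
    then have "distr (PiM UNIV (\<lambda>_. \<mu>)) (PiM UNIV (\<lambda>_. \<mu>)) (\<lambda>x. \<lambda>i\<in>UNIV. x (\<sigma> i)) = PiM UNIV (\<lambda>_. \<mu>)"
      using permutes_inj by (intro distr_PiM_reindex[where f = \<sigma> and M = "\<lambda>_. \<mu>"] \<mu>) auto
    then show "distr (PiM UNIV (\<lambda>_. \<mu>)) inf_space (\<lambda>x i. x (\<sigma> i)) = PiM UNIV (\<lambda>_. \<mu>)"
      using distr_cong[OF refl sets_PiM] by (metis (no_types, lifting) UNIV_I ext restrict_apply')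
  qed (rule sets_PiM)
  interpret product_prob_space "\<lambda>_::nat. \<mu>" UNIV
    using \<mu> by (simp add: product_prob_space_def product_prob_space_axioms_def product_sigma_finite_def
        prob_space_imp_sigma_finite)
  have "one_body (PiM UNIV (\<lambda>_. \<mu>)) = distr (PiM UNIV (\<lambda>_. \<mu>)) \<mu> (\<lambda>x. x (0::nat))"
    unfolding one_body_def by (rule distr_cong[OF refl sets[symmetric] refl])
  then show "one_body (PiM UNIV (\<lambda>_. \<mu>)) = \<mu>" by (simp add: PiM_component)
qed

text \<open>The swap sends the marginal on \<open>(0, 1)\<close> to the one on
  \<open>(1, 0)\<close>, and exchangeability identifies the two. The admissible pair laws are
  thereby exactly the two-body marginals of exchangeable laws with the given one-body
  marginal.\<close>

lemma two_body_P_sym2: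
  fixes \<gamma> :: "(nat \<Rightarrow> 'a::second_countable_topology) measure"
  assumes \<gamma>: "P_inf_sym \<gamma>"
  shows "P_sym2 (two_body \<gamma> 0 1)" "pair_marg (two_body \<gamma> 0 1) = one_body \<gamma>"
    "inf_representable (two_body \<gamma> 0 1)"
proof -
  have sets: "sets \<gamma> = sets inf_space" and "prob_space \<gamma>" using \<gamma> by (auto simp: P_inf_sym_def)
  have p: "(\<lambda>x::nat \<Rightarrow> 'a. (x i, x j)) \<in> borel_measurable \<gamma>" for i j
    unfolding measurable_cong_sets[OF sets refl]
    by (intro borel_measurable_Pair measurable_component_singleton) auto
  have s: "(\<lambda>(x, y). (y, x)) \<in> borel_measurable (borel :: ('a \<times> 'a) measure)"
    unfolding case_prod_beta by (intro borel_measurable_continuous_onI continuous_intros)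
  have "distr (two_body \<gamma> 0 1) borel (\<lambda>(x, y). (y, x)) = two_body \<gamma> 1 0"
    by (simp only: two_body_def distr_distr[OF s p] comp_def case_prod_conv)
  also have "\<dots> = two_body \<gamma> 0 1" by (rule two_body_eq[OF \<gamma>]) simp
  finally have swap: "distr (two_body \<gamma> 0 1) borel (\<lambda>(x, y). (y, x)) = two_body \<gamma> 0 1" .
  have "borel_prob (two_body \<gamma> 0 1)"
    using prob_space.prob_space_distr[OF \<open>prob_space \<gamma>\<close> p] by (simp add: borel_prob_def two_body_def)
  with swap show "P_sym2 (two_body \<gamma> 0 1)" unfolding P_sym2_def by (rule conjI[rotated])
  show "pair_marg (two_body \<gamma> 0 1) = one_body \<gamma>"
    unfolding pair_marg_def one_body_def by (rule distr_fst_two_body[OF sets])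
  show "inf_representable (two_body \<gamma> 0 1)"
    unfolding inf_representable_def using \<gamma> two_body_eq[OF \<gamma>] by blast
qed

text \<open>The direct method: by compactness a minimizing sequence has a limit along a subsequence;
  this limit is again admissible, and semicontinuity bounds its cost by the infimum.\<close>

lemma pair_cost_minimizer_exists:
  fixes c :: "real^'d \<Rightarrow> real^'d \<Rightarrow> ennreal" and \<mu> :: "(real^'d) measure"
  assumes c: "lsc (\<lambda>(x, y). c x y)" and \<mu>: "borel_prob \<mu>"
  obtains \<gamma> where "P_inf_sym \<gamma>" "one_body \<gamma> = \<mu>"
    "\<And>\<gamma>'. P_inf_sym \<gamma>' \<Longrightarrow> one_body \<gamma>' = \<mu> \<Longrightarrow> (\<integral>\<^sup>+x. c (x 0) (x 1) \<partial>\<gamma>) \<le> (\<integral>\<^sup>+x. c (x 0) (x 1) \<partial>\<gamma>')"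
proof -
  let ?S = "{\<gamma>. P_inf_sym \<gamma> \<and> one_body \<gamma> = \<mu>}"
  let ?V = "\<lambda>\<gamma>. \<integral>\<^sup>+x. c (x 0) (x 1) \<partial>\<gamma>"
  have "?S \<noteq> {}" using P_inf_sym_product[OF \<mu>] by blast
  \<comment> \<open>The infimum is the limit of a decreasing sequence of costs of competitors,
    possibly all infinite.\<close>
  then obtain v where v: "decseq v" "range v \<subseteq> ?V ` ?S" "(INF \<gamma>\<in>?S. ?V \<gamma>) = (INF i. v i)"
    using ennreal_Inf_countable_INF[of "?V ` ?S"] by auto
  then have "\<forall>n. \<exists>\<gamma>. \<gamma> \<in> ?S \<and> v n = ?V \<gamma>" by auto
  then obtain \<gamma> where "\<forall>n. \<gamma> n \<in> ?S \<and> v n = ?V (\<gamma> n)" by (rule exE[OF choice])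
  then have \<gamma>: "P_inf_sym (\<gamma> n)" "one_body (\<gamma> n) = \<mu>" "v n = ?V (\<gamma> n)" for n by auto
  have ps: "prob_space (\<gamma> n)" "sets (\<gamma> n) = sets inf_space" for n
    using \<gamma>(1) by (auto simp: P_inf_sym_def)
  obtain r \<gamma>' where r: "strict_mono r" and \<gamma>': "prob_space \<gamma>'" "sets \<gamma>' = sets inf_space"
    "\<And>j. distr \<gamma>' borel (\<lambda>x. x j) = \<mu>"
    and conv: "\<And>J f. finite J \<Longrightarrow>
      (\<lambda>n. emeasure (distr (\<gamma> (r n)) bit_space conf_bits) {\<omega>. \<forall>k\<in>J. \<omega> k = f k})
        \<longlonglongrightarrow> emeasure (distr \<gamma>' bit_space conf_bits) {\<omega>. \<forall>k\<in>J. \<omega> k = f k}"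
    by (rule configurations_compact[where \<gamma> = \<gamma>, OF ps one_coordinate_eq[OF \<gamma>(1), unfolded \<gamma>(2)]]) blast
  have "?V \<gamma>' \<le> liminf (\<lambda>n. ?V (\<gamma> (r n)))"
    using lsc_finite_bits[OF c, where i = 0 and j = 1]
    by (intro nn_integral_le_liminf_of_bits ps(2) \<gamma>'(2) conv) auto
  also have "\<dots> = (INF i. v i)"
  proof -
    have "v \<longlonglongrightarrow> (INF i. v i)" using v(1) by (rule LIMSEQ_INF)
    then have "(v \<circ> r) \<longlonglongrightarrow> (INF i. v i)" using r by (rule LIMSEQ_subseq_LIMSEQ)
    then show ?thesis by (simp add: comp_def \<gamma>(3) lim_imp_Liminf)
  qed
  finally have "?V \<gamma>' \<le> (INF \<gamma>\<in>?S. ?V \<gamma>)" using v(3) by simp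
  then have "?V \<gamma>' \<le> ?V \<rho>" if "P_inf_sym \<rho>" "one_body \<rho> = \<mu>" for \<rho>
    using that by (simp add: le_INF_iff)
  moreover have "P_inf_sym \<gamma>'" by (rule P_inf_sym_limit[OF \<gamma>(1) \<gamma>'(1,2) conv])
  moreover have "one_body \<gamma>' = \<mu>" using \<gamma>'(3) by (simp add: one_body_def)
  ultimately show thesis using that by blast
qed

theorem theorem2p7:
  fixes c :: "real^'d \<Rightarrow> real^'d \<Rightarrow> ennreal" and \<mu> :: "(real^'d) measure"
  assumes c_meas: "(\<lambda>(x, y). c x y) \<in> borel_measurable borel"
    and c_sym: "\<And>x y. c x y = c y x"
    and c_lsc: "lsc (\<lambda>(x, y). c x y)"
    and \<mu>: "borel_prob \<mu>"
  shows "(\<exists>\<gamma>. P_inf_sym \<gamma> \<and> one_body \<gamma> = \<mu> \<and> C_inf c \<gamma> = F_OT_inf c \<mu>)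
    \<and> (\<exists>\<mu>2. P_sym2 \<mu>2 \<and> pair_marg \<mu>2 = \<mu> \<and> inf_representable \<mu>2 \<and>
          (\<integral>\<^sup>+ p. c (fst p) (snd p) \<partial>\<mu>2) =
          (INF \<nu> \<in> {\<nu>. P_sym2 \<nu> \<and> pair_marg \<nu> = \<mu> \<and> inf_representable \<nu>}.
              \<integral>\<^sup>+ p. c (fst p) (snd p) \<partial>\<nu>))"
proof -
  \<comment> \<open>One exchangeable minimizer yields both claims: its limiting cost and the cost of
    its two-body marginal are the same pair integral.\<close>
  obtain \<gamma> where \<gamma>: "P_inf_sym \<gamma>" "one_body \<gamma> = \<mu>"
    and min: "\<And>\<gamma>'. P_inf_sym \<gamma>' \<Longrightarrow> one_body \<gamma>' = \<mu> \<Longrightarrow>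
      (\<integral>\<^sup>+x. c (x 0) (x 1) \<partial>\<gamma>) \<le> (\<integral>\<^sup>+x. c (x 0) (x 1) \<partial>\<gamma>')"
    using pair_cost_minimizer_exists[OF c_lsc \<mu>] by blast
  have cost: "(\<integral>\<^sup>+p. c (fst p) (snd p) \<partial>two_body \<rho> 0 1) = (\<integral>\<^sup>+x. c (x 0) (x 1) \<partial>\<rho>)"
    if "P_inf_sym \<rho>" for \<rho>
    using that nn_integral_two_body(1)[OF _ c_meas, of \<rho> 0 1] by (simp add: P_inf_sym_def)
  have "C_inf c \<gamma> = F_OT_inf c \<mu>"
    unfolding F_OT_inf_def
  proof (rule antisym)
    show "C_inf c \<gamma> \<le> (INF \<gamma>\<in>{\<gamma>. P_inf_sym \<gamma> \<and> one_body \<gamma> = \<mu>}. C_inf c \<gamma>)"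
      by (rule INF_greatest) (use \<gamma> min in \<open>auto simp: C_inf_eq c_meas\<close>)
    show "(INF \<gamma>\<in>{\<gamma>. P_inf_sym \<gamma> \<and> one_body \<gamma> = \<mu>}. C_inf c \<gamma>) \<le> C_inf c \<gamma>"
      by (rule INF_lower) (use \<gamma> in simp)
  qed
  moreover have "(\<integral>\<^sup>+p. c (fst p) (snd p) \<partial>two_body \<gamma> 0 1) =
      (INF \<nu>\<in>{\<nu>. P_sym2 \<nu> \<and> pair_marg \<nu> = \<mu> \<and> inf_representable \<nu>}. \<integral>\<^sup>+p. c (fst p) (snd p) \<partial>\<nu>)"
  proof (rule antisym)
    show "(\<integral>\<^sup>+p. c (fst p) (snd p) \<partial>two_body \<gamma> 0 1) \<le>
        (INF \<nu>\<in>{\<nu>. P_sym2 \<nu> \<and> pair_marg \<nu> = \<mu> \<and> inf_representable \<nu>}. \<integral>\<^sup>+p. c (fst p) (snd p) \<partial>\<nu>)"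
    proof (rule INF_greatest)
      fix \<nu> assume "\<nu> \<in> {\<nu>. P_sym2 \<nu> \<and> pair_marg \<nu> = \<mu> \<and> inf_representable \<nu>}"
      \<comment> \<open>A representable \<open>\<nu>\<close> is the two-body marginal of some
        \<open>\<rho>\<close>, whose one-body marginal is that of \<open>\<nu>\<close>, namely
        \<open>\<mu>\<close>; so \<open>\<rho>\<close> competes with
        \<open>\<gamma>\<close>.\<close>
      then obtain \<rho> where \<rho>: "P_inf_sym \<rho>" "two_body \<rho> 0 1 = \<nu>" "pair_marg \<nu> = \<mu>"
        by (auto simp: inf_representable_def)
      then have "one_body \<rho> = \<mu>" using two_body_P_sym2(2)[OF \<rho>(1)] by simp
      then show "(\<integral>\<^sup>+p. c (fst p) (snd p) \<partial>two_body \<gamma> 0 1) \<le> (\<integral>\<^sup>+p. c (fst p) (snd p) \<partial>\<nu>)"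
        using min[OF \<rho>(1)] cost[OF \<rho>(1)] cost[OF \<gamma>(1)] \<rho>(2) by simp
    qed
    show "(INF \<nu>\<in>{\<nu>. P_sym2 \<nu> \<and> pair_marg \<nu> = \<mu> \<and> inf_representable \<nu>}. \<integral>\<^sup>+p. c (fst p) (snd p) \<partial>\<nu>) \<le>
        (\<integral>\<^sup>+p. c (fst p) (snd p) \<partial>two_body \<gamma> 0 1)"
      by (rule INF_lower) (use two_body_P_sym2[OF \<gamma>(1)] \<gamma>(2) in simp)
  qed
  ultimately show ?thesis
    using \<gamma> two_body_P_sym2[OF \<gamma>(1)] by metis
qed

end
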